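(* Assume $\sigma^2, \tilde b \in C^1([0,1])$ with $\min_{[0,1]} \sigma^2 > 0$, and let $\tilde f \in C^1([0,1])$, given in terms of the birth and death intensities as in the context, satisfy $\tilde f(0) = \tilde f(1) = 0$, with exactly one interior zero $q^* \in (0,1)$, $\tilde f < 0$ on $(0, q^* )$, $\tilde f > 0$ on $(q^*, 1)$, and $\tilde f'(0) < 0$, $\tilde f'(q^* ) > 0$, $\tilde f'(1) < 0$. Let $(c,V)$ be the traveling wave described in the context, let $$\alpha = \frac{a + \sqrt{a^{2} - 2\,\sigma^{2}(1)\,\tilde f'(1)}}{\sigma^{2}(1)}, \qquad a = c - \tilde b(1),$$ be its tail exponent, and let $0 \leq p < \alpha$. Then $$G^p = c + (1 - p)\, G^p_* + \Big\langle \frac{\tilde f}{g},\, \bar\Pi^p \Big\rangle - \big\langle \lambda_d,\, \bar\Pi^p \big\rangle, \qquad G^p_* := \tfrac{1}{2}\, \langle \sigma^2, \bar\Pi^p \rangle,$$ where $G^p=\langle b,\bar\Pi^p\rangle-\langle\lambda_d,\bar\Pi^p\rangle$ is the growth rate of the $p$-diversity-weighted portfolio along the wave.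
   Context: Let $\lambda_b,\lambda_d:[0,1]\to[0,\infty)$ be continuous (birth and death intensities), $f(q)=\int_0^q(\lambda_b(r)-\lambda_d(r))\,dr$, and $\tilde f(q)=f(q)-qf(1)$. Here $\sigma^2:[0,1]\to(0,\infty)$ and $b=\tilde b+\sigma^2/2$. Traveling wave: there is a unique $c\in\mathbb{R}$, and a profile $V$ unique up to translation, with $V\in C^2(\mathbb{R})$ strictly increasing, $V(-\infty)=0$, $V(+\infty)=1$, and $$\frac{d}{d\xi}\Big(\frac{\sigma^2(V)}{2}\,V'\Big) + \big(c - \tilde b(V)\big)\,V' + \tilde f(V) = 0 .$$ Let $\Xi=V^{-1}:(0,1)\to\mathbb{R}$ be the quantile function and $g(s)=V'(\Xi(s))$, so $\Xi'=1/g$. The $p$-weighted capital measure is the probability measure on $(0,1)$ $$\bar\Pi^p(ds)=\frac{e^{p\,\Xi(s)}}{\bar Z(p)}\,ds,\qquad \bar Z(p)=\int_0^1 e^{p\,\Xi(r)}\,dr,$$ where $\bar Z(p)<\infty$ for $p<\alpha$; and $\langle h,\bar\Pi^p\rangle=\int_0^1 h(s)\,\bar\Pi^p(ds)$. The quantity $G^p_*$ is called the excess growth rate. *)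

theory Defs
  imports "HOL-Probability.Probability"
begin

text \<open>
  Coefficients are total functions on the reals of which only the values on the unit interval
  matter.  Derivatives of such functions are therefore taken within the unit interval, hence
  one-sided at 0 and 1.
\<close>

definition deriv_unit :: "(real \<Rightarrow> real) \<Rightarrow> real \<Rightarrow> real" where
  "deriv_unit h x = vector_derivative h (at x within {0..1})"

definition C1_unit :: "(real \<Rightarrow> real) \<Rightarrow> bool" where
  "C1_unit h \<longleftrightarrow> h differentiable_on {0..1} \<and> continuous_on {0..1} (deriv_unit h)"

definition net_growth :: "(real \<Rightarrow> real) \<Rightarrow> (real \<Rightarrow> real) \<Rightarrow> real \<Rightarrow> real" where
  "net_growth lb ld q = integral {0..q} (\<lambda>r. lb r - ld r)"

definition reaction :: "(real \<Rightarrow> real) \<Rightarrow> (real \<Rightarrow> real) \<Rightarrow> real \<Rightarrow> real" where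
  "reaction lb ld q = net_growth lb ld q - q * net_growth lb ld 1"

text \<open>
  The arguments are the squared volatility, the drift (the one carrying a tilde, without the
  Ito correction), the reaction term, the speed and the profile.
\<close>

definition traveling_wave ::
  "(real \<Rightarrow> real) \<Rightarrow> (real \<Rightarrow> real) \<Rightarrow> (real \<Rightarrow> real) \<Rightarrow> real \<Rightarrow> (real \<Rightarrow> real) \<Rightarrow> bool" where
  "traveling_wave \<sigma>2 bt ft c V \<longleftrightarrow>
     V C1_differentiable_on UNIV \<and> deriv V C1_differentiable_on UNIV \<and>
     strict_mono V \<and> (V \<longlongrightarrow> 0) at_bot \<and> (V \<longlongrightarrow> 1) at_top \<and>
     (\<forall>\<xi>. deriv (\<lambda>x. \<sigma>2 (V x) / 2 * deriv V x) \<xi>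
           + (c - bt (V \<xi>)) * deriv V \<xi> + ft (V \<xi>) = 0)"

definition tail_exponent ::
  "(real \<Rightarrow> real) \<Rightarrow> (real \<Rightarrow> real) \<Rightarrow> (real \<Rightarrow> real) \<Rightarrow> real \<Rightarrow> real" where
  "tail_exponent \<sigma>2 bt ft c =
     (let a = c - bt 1
      in (a + sqrt (a\<^sup>2 - 2 * \<sigma>2 1 * deriv_unit ft 1)) / \<sigma>2 1)"

text \<open>
  A strictly increasing continuous profile with limits 0 and 1 has range \<open>{0<..<1}\<close>, so the
  Hilbert-choice inverse below is the genuine inverse there; it is only used at such arguments.
\<close>

definition wave_quantile :: "(real \<Rightarrow> real) \<Rightarrow> real \<Rightarrow> real" where
  "wave_quantile V = inv V"

definition quantile_slope :: "(real \<Rightarrow> real) \<Rightarrow> real \<Rightarrow> real" where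
  "quantile_slope V s = deriv V (wave_quantile V s)"

text \<open>The normalizing constant is extended-valued, so that its finiteness is not presupposed.\<close>

definition capital_Z :: "(real \<Rightarrow> real) \<Rightarrow> real \<Rightarrow> ennreal" where
  "capital_Z V p = (\<integral>\<^sup>+ s \<in> {0<..<1}. ennreal (exp (p * wave_quantile V s)) \<partial>lborel)"

definition capital_measure :: "(real \<Rightarrow> real) \<Rightarrow> real \<Rightarrow> real measure" where
  "capital_measure V p =
     density (restrict_space lborel {0<..<1})
       (\<lambda>s. ennreal (exp (p * wave_quantile V s)) / capital_Z V p)"

definition capital_mean :: "(real \<Rightarrow> real) \<Rightarrow> real \<Rightarrow> (real \<Rightarrow> real) \<Rightarrow> real" where
  "capital_mean V p h = integral\<^sup>L (capital_measure V p) h"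

definition growth_rate ::
  "(real \<Rightarrow> real) \<Rightarrow> (real \<Rightarrow> real) \<Rightarrow> (real \<Rightarrow> real) \<Rightarrow> (real \<Rightarrow> real) \<Rightarrow> real \<Rightarrow> real" where
  "growth_rate \<sigma>2 bt ld V p =
     capital_mean V p (\<lambda>s. bt s + \<sigma>2 s / 2) - capital_mean V p ld"

definition excess_growth_rate :: "(real \<Rightarrow> real) \<Rightarrow> (real \<Rightarrow> real) \<Rightarrow> real \<Rightarrow> real" where
  "excess_growth_rate \<sigma>2 V p = 1 / 2 * capital_mean V p \<sigma>2"

end

theory Submission
  imports Defs "HOL-Real_Asymp.Real_Asymp"
begin

text \<open>
  Substituting \<open>s = V x\<close> turns every mean under the capital measure into an integral over the
  line with weight \<open>exp (p x) V' x\<close>.  Multiplying the wave equation by \<open>exp (p x)\<close> and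
  integrating by parts the derivative of the flux \<open>\<sigma>2 (V) V' / 2\<close> gives
  \<open>\<langle>ft / g\<rangle> = p / 2 \<langle>\<sigma>2\<rangle> - c + \<langle>bt\<rangle>\<close>, which is the claim up to rearrangement.  Integrability and
  the vanishing of the boundary terms follow from exponential tails of \<open>V'\<close> and \<open>ft (V)\<close>: at
  every rate below \<open>\<alpha>\<close> at \<open>+\<infinity>\<close>, and, by reflection, at some positive rate at \<open>-\<infinity>\<close>, where
  \<open>p \<ge> 0\<close> makes the weight harmless.
\<close>

section \<open>Decay and integration of functions on the line\<close>

text \<open>Completing the square: \<open>4 * s * (s * r\<^sup>2 - a * r - k)\<close> equals
  \<open>(2 * s * r - a)\<^sup>2\<close> minus the discriminant. The roots have opposite signs
  because \<open>k\<close> is positive, so \<open>0 \<le> r\<close> already places \<open>r\<close>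
  above the smaller one.\<close>

lemma between_roots_imp_quadratic_neg:
  fixes s a k r :: real
  assumes "0 < s" "0 < k" "0 \<le> r" "r < (a + sqrt (a\<^sup>2 + 4 * s * k)) / (2 * s)"
  shows "s * r\<^sup>2 - a * r < k"
proof -
  let ?D = "a\<^sup>2 + 4 * s * k"
  have "sqrt (a\<^sup>2) < sqrt ?D"
    using assms by (intro real_sqrt_less_mono) simp
  then have "- sqrt ?D < 2 * s * r - a"
    using assms by (smt (verit) mult_nonneg_nonneg real_sqrt_abs)
  moreover have "2 * s * r - a < sqrt ?D"
    using assms by (simp add: field_simps)
  ultimately have "\<bar>2 * s * r - a\<bar> < sqrt ?D" by linarith
  then have "\<bar>2 * s * r - a\<bar>\<^sup>2 < (sqrt ?D)\<^sup>2" by (intro power_strict_mono) auto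
  then have "(2 * s * r - a)\<^sup>2 < ?D" using assms by simp
  then have "4 * s * (s * r\<^sup>2 - a * r) < 4 * s * k"
    by (simp add: power2_eq_square algebra_simps)
  then show ?thesis using assms(1) by simp
qed

text \<open>
  The function \<open>exp (r x) (S U1 + k' U / r)\<close>, for \<open>k'\<close> slightly below \<open>k\<close>, is eventually
  nonincreasing: this is exactly where \<open>r\<close> has to lie below the positive root of the
  characteristic polynomial.
\<close>

lemma exponential_decay_at_top:
  fixes U U1 S A F :: "real \<Rightarrow> real"
  assumes dU: "\<And>x. (U has_real_derivative - U1 x) (at x)"
    and dW: "\<And>x. ((\<lambda>x. S x * U1 x) has_real_derivative - A x * U1 x - F x) (at x)"
    and pos: "\<And>x. 0 < U x" "\<And>x. 0 \<le> U1 x"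
    and lim: "(S \<longlongrightarrow> s) at_top" "(A \<longlongrightarrow> a) at_top" "((\<lambda>x. F x / U x) \<longlongrightarrow> k) at_top"
    and "0 < s" "0 < k" "0 < r" and char: "s * r\<^sup>2 - a * r < k"
  shows "U \<in> O(\<lambda>x. exp (- r * x))" "U1 \<in> O(\<lambda>x. exp (- r * x))"
proof -
  \<comment> \<open>The maximum with 0 makes \<open>k'\<close> positive, so that the term
    \<open>k' / r * U x\<close> is nonnegative and can later be bounded on its own.\<close>
  obtain k' where k': "max 0 (s * r\<^sup>2 - a * r) < k'" "k' < k"
    using dense[of "max 0 (s * r\<^sup>2 - a * r)" k] char \<open>0 < k\<close> by auto
  have "((\<lambda>x. S x * r\<^sup>2 - A x * r) \<longlongrightarrow> s * r\<^sup>2 - a * r) at_top"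
    by (intro tendsto_intros lim)
  then have "\<forall>\<^sub>F x in at_top. S x * r\<^sup>2 - A x * r < k'"
    using k' by (intro order_tendstoD(2)[of _ "s * r\<^sup>2 - a * r"]) auto
  moreover have "\<forall>\<^sub>F x in at_top. k' < F x / U x"
    using order_tendstoD(1)[OF lim(3)] k'(2) by blast
  moreover have "\<forall>\<^sub>F x in at_top. s / 2 < S x"
    using order_tendstoD(1)[OF lim(1), of "s / 2"] \<open>0 < s\<close> by simp
  ultimately have "\<forall>\<^sub>F x in at_top. S x * r\<^sup>2 - A x * r < k' \<and> k' < F x / U x \<and> s / 2 < S x"
    by eventually_elim auto
  then obtain N where N: "\<And>x. N \<le> x \<Longrightarrow> S x * r\<^sup>2 - A x * r < k'"
      "\<And>x. N \<le> x \<Longrightarrow> k' < F x / U x" "\<And>x. N \<le> x \<Longrightarrow> s / 2 < S x"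
    unfolding eventually_at_top_linorder by blast
  define \<Phi> where "\<Phi> x = exp (r * x) * (S x * U1 x + k' / r * U x)" for x
  define M where "M = \<Phi> N"
  \<comment> \<open>The terms are grouped so that each is nonpositive beyond \<open>N\<close>: the
    first by the characteristic inequality, the second because \<open>F / U\<close> exceeds
    \<open>k'\<close>.\<close>
  have d\<Phi>: "(\<Phi> has_real_derivative
      exp (r * x) * (U1 x / r * (S x * r\<^sup>2 - A x * r - k') + (k' * U x - F x))) (at x)" for x
  proof -
    have "((\<lambda>x. exp (r * x)) has_real_derivative r * exp (r * x)) (at x)"
      by (auto intro!: derivative_eq_intros)
    from DERIV_mult[OF this DERIV_add[OF dW DERIV_cmult[OF dU, of "k' / r"]]]
    show ?thesis
      unfolding \<Phi>_def
      by (rule DERIV_cong) (use \<open>0 < r\<close> in \<open>simp add: field_simps power2_eq_square\<close>)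
  qed
  have \<Phi>_le: "\<Phi> x \<le> M" if "N \<le> x" for x
    unfolding M_def
  proof (rule DERIV_nonpos_imp_nonincreasing[OF that])
    fix y assume y: "N \<le> y" "y \<le> x"
    have "U1 y / r * (S y * r\<^sup>2 - A y * r - k') \<le> 0"
      using N(1)[OF y(1)] pos(2)[of y] \<open>0 < r\<close> by (intro mult_nonneg_nonpos) auto
    moreover have "k' * U y - F y \<le> 0"
      using N(2)[OF y(1)] pos(1)[of y] by (simp add: field_simps)
    ultimately show "\<exists>z. (\<Phi> has_real_derivative z) (at y) \<and> z \<le> 0"
      using d\<Phi>[of y] by (meson add_nonpos_nonpos exp_ge_zero mult_nonneg_nonpos)
  qed
  have bound: "s / 2 * U1 x \<le> M * exp (- r * x) \<and> k' / r * U x \<le> M * exp (- r * x)"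
    if "N \<le> x" for x
  proof -
    have "S x * U1 x + k' / r * U x \<le> M * exp (- r * x)"
      using \<Phi>_le[OF that] by (simp add: \<Phi>_def exp_minus field_simps)
    moreover have "s / 2 * U1 x \<le> S x * U1 x"
      using N(3)[OF that] pos(2)[of x] by (intro mult_right_mono) auto
    moreover have "0 \<le> s / 2 * U1 x" "0 \<le> k' / r * U x"
      using pos(1)[of x] pos(2)[of x] \<open>0 < s\<close> \<open>0 < r\<close> k'(1) by auto
    ultimately show ?thesis by linarith
  qed
  show "U1 \<in> O(\<lambda>x. exp (- r * x))"
  proof (rule bigoI[of _ "2 * M / s"], rule eventually_mono[OF eventually_ge_at_top[of N]])
    fix x assume "N \<le> x"
    with bound[of x] pos(2)[of x] \<open>0 < s\<close>
    show "norm (U1 x) \<le> 2 * M / s * norm (exp (- r * x))" by (simp add: field_simps)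
  qed
  show "U \<in> O(\<lambda>x. exp (- r * x))"
  proof (rule bigoI[of _ "M * r / k'"], rule eventually_mono[OF eventually_ge_at_top[of N]])
    fix x assume "N \<le> x"
    with bound[of x] pos(1)[of x] k'(1) \<open>0 < r\<close>
    show "norm (U x) \<le> M * r / k' * norm (exp (- r * x))" by (simp add: field_simps)
  qed
qed

text \<open>Both exponentials are dominated by \<open>inverse (1 + x\<^sup>2)\<close>, so a single
  integrable majorant serves the two tails and, by compactness, the middle.\<close>

lemma integrable_exponential_tails:
  fixes f :: "real \<Rightarrow> real"
  assumes f: "continuous_on UNIV f" and "0 < r" "0 < q"
    and top: "f \<in> O(\<lambda>x. exp (- r * x))" and bot: "f \<in> O[at_bot](\<lambda>x. exp (q * x))"
  shows "integrable lborel f"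
proof -
  have "(\<lambda>x. exp (- r * x)) \<in> O(\<lambda>x. inverse (1 + x\<^sup>2))"
    using \<open>0 < r\<close> by real_asymp
  with top have "f \<in> O(\<lambda>x. inverse (1 + x\<^sup>2))" by (rule landau_o.big.trans)
  then obtain C where C: "\<forall>\<^sub>F x in at_top. norm (f x) \<le> C * norm (inverse (1 + x\<^sup>2))"
    by (elim landau_o.bigE)
  have "(\<lambda>x. exp (q * x)) \<in> O[at_bot](\<lambda>x. inverse (1 + x\<^sup>2))"
    using \<open>0 < q\<close> by real_asymp
  with bot have "f \<in> O[at_bot](\<lambda>x. inverse (1 + x\<^sup>2))" by (rule landau_o.big.trans)
  then obtain D where D: "\<forall>\<^sub>F x in at_bot. norm (f x) \<le> D * norm (inverse (1 + x\<^sup>2))"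
    by (elim landau_o.bigE)
  from C obtain N where N: "\<And>x. N \<le> x \<Longrightarrow> norm (f x) \<le> C * norm (inverse (1 + x\<^sup>2))"
    unfolding eventually_at_top_linorder by blast
  from D obtain L where L: "\<And>x. x \<le> L \<Longrightarrow> norm (f x) \<le> D * norm (inverse (1 + x\<^sup>2))"
    unfolding eventually_at_bot_linorder by blast
  \<comment> \<open>If \<open>N < L\<close>, this interval is empty and the two tails already cover
    the line.\<close>
  have "bounded ((\<lambda>x. f x * (1 + x\<^sup>2)) ` {L..N})"
    by (intro compact_imp_bounded compact_continuous_image continuous_intros
        continuous_on_subset[OF f]) auto
  then obtain B where "\<forall>y \<in> (\<lambda>x. f x * (1 + x\<^sup>2)) ` {L..N}. norm y \<le> B"
    unfolding bounded_iff ..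
  then have B: "norm (f x * (1 + x\<^sup>2)) \<le> B" if "x \<in> {L..N}" for x
    using that by blast
  define M where "M = max B (max C D)"
  have sq: "0 < 1 + x\<^sup>2" for x :: real
    by (simp add: add_pos_nonneg)
  have bound: "norm (f x) \<le> norm (M * inverse (1 + x\<^sup>2))" for x
  proof -
    have "norm (f x) * (1 + x\<^sup>2) \<le> M"
    proof -
      consider "N \<le> x" | "x \<le> L" | "x \<in> {L..N}" by fastforce
      then show ?thesis
        using N[of x] L[of x] B[of x] sq[of x]
        by cases (auto simp: M_def field_simps abs_mult)
    qed
    also have "M \<le> \<bar>M\<bar>" by simp
    finally show ?thesis using sq[of x] by (simp add: field_simps abs_mult)
  qed
  have "integrable lborel (\<lambda>x::real. M * inverse (1 + x\<^sup>2))"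
    using integrable_inverse_1_plus_square by (simp add: set_integrable_def)
  then show ?thesis
    by (rule Bochner_Integration.integrable_bound)
      (use f bound in \<open>auto simp del: real_norm_def intro!: borel_measurable_continuous_onI\<close>)
qed

text \<open>The fundamental theorem of calculus between the infinite endpoints; it carries out the
  integration by parts once applied to the weighted flux.\<close>

lemma integral_derivative_vanishing_limits:
  fixes F f :: "real \<Rightarrow> real"
  assumes "\<And>x. (F has_real_derivative f x) (at x)" "continuous_on UNIV f" "integrable lborel f"
    and "(F \<longlongrightarrow> 0) at_bot" "(F \<longlongrightarrow> 0) at_top"
  shows "(\<integral>x. f x \<partial>lborel) = 0"
proof -
  have "(LBINT x=-\<infinity>..\<infinity>. f x) = 0 - 0"
  proof (rule interval_integral_FTC_integrable)
    show "((F \<circ> real_of_ereal) \<longlongrightarrow> 0) (at_right (-\<infinity>))"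
      "((F \<circ> real_of_ereal) \<longlongrightarrow> 0) (at_left \<infinity>)"
      using assms by (simp_all add: ereal_tendsto_simps)
  qed (use assms in \<open>auto simp: has_real_derivative_iff_has_vector_derivative
      continuous_on_eq_continuous_at set_integrable_def\<close>)
  then show ?thesis
    by (simp add: interval_lebesgue_integral_def set_lebesgue_integral_def)
qed

section \<open>Means under the capital measure as integrals along the profile\<close>

lemma measurable_restrict_lborel:
  "borel_measurable (restrict_space lborel A) = borel_measurable (restrict_space borel A)"
  by (intro measurable_cong_sets sets_restrict_space_cong) auto

lemma measurable_of_continuous_unit:
  "continuous_on {0..1} h \<Longrightarrow> h \<in> borel_measurable (restrict_space borel {0<..<1::real})"
  for h :: "real \<Rightarrow> real"
  by (intro borel_measurable_continuous_on_restrict) (auto intro: continuous_on_subset)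

locale profile =
  fixes V V' :: "real \<Rightarrow> real"
  assumes DERIV_V: "\<And>x. (V has_real_derivative V' x) (at x)"
    and continuous_V': "continuous_on UNIV V'"
    and strict_mono_V: "strict_mono V"
    and V_at_bot: "(V \<longlongrightarrow> 0) at_bot"
    and V_at_top: "(V \<longlongrightarrow> 1) at_top"
begin

lemma deriv_V: "deriv V = V'"
  using DERIV_V by (auto intro: DERIV_imp_deriv)

lemma continuous_V: "continuous_on A V"
  by (rule DERIV_continuous_on) (rule has_field_derivative_at_within[OF DERIV_V])

lemma V'_nonneg: "0 \<le> V' x"
  by (rule mono_on_imp_deriv_nonneg[OF _ DERIV_V, of UNIV])
    (simp_all add: strict_mono_V strict_mono_mono)

text \<open>The limits alone give weak bounds; strict monotonicity over one further unit makes them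
  strict.\<close>

lemma V_bounds: "0 < V x" "V x < 1"
proof -
  have "0 \<le> V (x - 1)"
    by (rule tendsto_upperbound[OF V_at_bot])
      (auto intro!: eventually_mono[OF eventually_le_at_bot[of "x - 1"]]
        simp: strict_mono_less_eq[OF strict_mono_V])
  also have "V (x - 1) < V x" using strict_mono_V by (simp add: strict_mono_less)
  finally show "0 < V x" .
  have "V x < V (x + 1)" using strict_mono_V by (simp add: strict_mono_less)
  also have "V (x + 1) \<le> 1"
    by (rule tendsto_lowerbound[OF V_at_top])
      (auto intro!: eventually_mono[OF eventually_ge_at_top[of "x + 1"]]
        simp: strict_mono_less_eq[OF strict_mono_V])
  finally show "V x < 1" .
qed

lemma range_V: "range V = {0<..<1}"
proof
  show "{0<..<1} \<subseteq> range V"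
  proof
    fix s :: real assume s: "s \<in> {0<..<1}"
    then obtain a where "V a < s"
      using order_tendstoD(2)[OF V_at_bot, of s] by (auto dest: eventually_happens)
    moreover obtain b where "s < V b"
      using order_tendstoD(1)[OF V_at_top, of s] s by (auto dest: eventually_happens)
    ultimately have "a \<le> b" "V a \<le> s" "s \<le> V b"
      using strict_mono_less_eq[OF strict_mono_V, of a b] by auto
    then obtain x where "V x = s"
      using IVT'[of V a s b] continuous_V by blast
    then show "s \<in> range V" by blast
  qed
qed (use V_bounds in auto)

lemma wave_quantile_V [simp]: "wave_quantile V (V x) = x"
  unfolding wave_quantile_def by (simp add: strict_mono_V strict_mono_imp_inj_on)

lemma quantile_slope_V [simp]: "quantile_slope V (V x) = V' x"
  by (simp add: quantile_slope_def deriv_V)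

lemma continuous_wave_quantile: "continuous_on {0<..<1} (wave_quantile V)"
  using continuous_on_inverse_open[of UNIV V "wave_quantile V"] continuous_V range_V
  by simp

lemma continuous_quantile_slope: "continuous_on {0<..<1} (quantile_slope V)"
  unfolding quantile_slope_def deriv_V
  by (rule continuous_on_compose2[OF continuous_V' continuous_wave_quantile]) auto

text \<open>Change of variables for the injective map \<open>V\<close>, whose absolute Jacobian is
  \<open>V'\<close> because \<open>V'\<close> is nonnegative. Integrability passes from the line to
  the unit interval, since the tail estimates are available on the line.\<close>

lemma substitution:
  assumes h: "h \<in> borel_measurable (restrict_space borel {0<..<1})"
    and int: "integrable lborel (\<lambda>x. V' x * h (V x))"
  shows "set_integrable lborel {0<..<1} h"
    and "(LBINT s:{0<..<1}. h s) = (\<integral>x. V' x * h (V x) \<partial>lborel)"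
proof -
  \<comment> \<open>The change of variables lives on the completed measure; Borel measurability is
    what permits the return to \<open>lborel\<close>.\<close>
  have meas: "(\<lambda>s. indicator {0<..<1} s *\<^sub>R h s) \<in> borel_measurable borel"
    using h by (simp add: borel_measurable_restrict_space_iff)
  have int': "(\<lambda>x. V' x * h (V x)) absolutely_integrable_on UNIV"
    using int by (simp add: set_integrable_def integrable_completion)
  have "h absolutely_integrable_on range V \<and>
      integral (range V) h = integral UNIV (\<lambda>x. V' x * h (V x))"
    using has_absolute_integral_change_of_variables_1'
      [of UNIV V V' h "integral UNIV (\<lambda>x. V' x * h (V x))"] int' V'_nonneg DERIV_V strict_mono_V
    by (simp add: strict_mono_imp_inj_on)
  then have h': "set_integrable lebesgue {0<..<1} h"
      and eq: "integral {0<..<1} h = integral UNIV (\<lambda>x. V' x * h (V x))"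
    by (simp_all add: range_V)
  show int_h: "set_integrable lborel {0<..<1} h"
    using h' meas by (simp add: set_integrable_def integrable_completion)
  show "(LBINT s:{0<..<1}. h s) = (\<integral>x. V' x * h (V x) \<partial>lborel)"
    using eq set_borel_integral_eq_integral(2)[OF int_h] integral_lborel[OF int] by simp
qed

text \<open>This is \<open>capital_Z\<close> as a real number, after the substitution
  \<open>s = V x\<close>; \<open>capital_Z_eq\<close> proves the agreement once the weight is
  integrable.\<close>

definition partition_const :: "real \<Rightarrow> real" where
  "partition_const p = (\<integral>x. V' x * exp (p * x) \<partial>lborel)"

context
  fixes p :: real
  assumes integrable_weight: "integrable lborel (\<lambda>x. V' x * exp (p * x))"
begin

lemma measurable_weight:
  "(\<lambda>s. exp (p * wave_quantile V s)) \<in> borel_measurable (restrict_space borel {0<..<1})"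
  by (intro borel_measurable_continuous_on_restrict continuous_intros continuous_wave_quantile)

lemma set_integrable_weight: "set_integrable lborel {0<..<1} (\<lambda>s. exp (p * wave_quantile V s))"
  and LBINT_weight: "(LBINT s:{0<..<1}. exp (p * wave_quantile V s)) = partition_const p"
  using substitution[OF measurable_weight] integrable_weight by (simp_all add: partition_const_def)

text \<open>Argued on the unit interval, where the weight is a positive exponential: a vanishing
  integral would make the interval a null set. Possible zeros of \<open>V'\<close> thus cause no
  trouble.\<close>

lemma partition_const_pos: "0 < partition_const p"
proof -
  let ?f = "\<lambda>s. indicator {0<..<1::real} s *\<^sub>R exp (p * wave_quantile V s)"
  have "0 \<le> partition_const p"
    unfolding partition_const_def by (intro Bochner_Integration.integral_nonneg) (simp add: V'_nonneg)
  moreover have "partition_const p \<noteq> 0"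
  proof
    assume "partition_const p = 0"
    then have "(\<integral>s. ?f s \<partial>lborel) = 0"
      using LBINT_weight by (simp add: set_lebesgue_integral_def)
    then have "AE s in lborel. ?f s = 0"
      using set_integrable_weight
      by (subst (asm) integral_nonneg_eq_0_iff_AE) (auto simp: set_integrable_def)
    then have "AE s in lborel. s \<notin> {0<..<1::real}"
      by eventually_elim (auto simp: indicator_def)
    then have "{0<..<1::real} \<in> null_sets lborel"
      by (subst AE_iff_null_sets) auto
    then show False by (simp add: null_sets_def)
  qed
  ultimately show ?thesis by simp
qed

lemma capital_Z_eq: "capital_Z V p = ennreal (partition_const p)"
proof -
  have "capital_Z V p
      = (\<integral>\<^sup>+ s. ennreal (indicator {0<..<1} s *\<^sub>R exp (p * wave_quantile V s)) \<partial>lborel)"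
    unfolding capital_Z_def by (intro nn_integral_cong) (auto simp: indicator_def)
  also have "\<dots> = ennreal (LBINT s:{0<..<1}. exp (p * wave_quantile V s))"
    unfolding set_lebesgue_integral_def
    using set_integrable_weight by (intro nn_integral_eq_integral) (auto simp: set_integrable_def)
  finally show ?thesis by (simp add: LBINT_weight)
qed

lemma capital_measure_eq:
  "capital_measure V p = density (restrict_space lborel {0<..<1})
     (\<lambda>s. ennreal (exp (p * wave_quantile V s) / partition_const p))"
  unfolding capital_measure_def capital_Z_eq
  by (simp add: divide_ennreal partition_const_pos)

lemma prob_space_capital_measure: "prob_space (capital_measure V p)"
proof
  let ?R = "restrict_space lborel {0<..<1::real}"
  have meas: "(\<lambda>s. ennreal (exp (p * wave_quantile V s))) \<in> borel_measurable ?R"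
    using measurable_weight by (simp add: measurable_restrict_lborel)
  have "emeasure (capital_measure V p) (space (capital_measure V p))
      = (\<integral>\<^sup>+ s. ennreal (exp (p * wave_quantile V s)) / capital_Z V p \<partial>?R)"
    unfolding capital_measure_def using meas
    by (subst emeasure_density)
      (auto simp: sets_restrict_space_iff intro!: nn_integral_cong borel_measurable_divide_ennreal)
  also have "\<dots> = (\<integral>\<^sup>+ s. ennreal (exp (p * wave_quantile V s)) \<partial>?R) / capital_Z V p"
    by (rule nn_integral_divide[OF meas])
  also have "(\<integral>\<^sup>+ s. ennreal (exp (p * wave_quantile V s)) \<partial>?R) = capital_Z V p"
    unfolding capital_Z_def by (subst nn_integral_restrict_space) auto
  \<comment> \<open>Cancellation in \<open>ennreal\<close> requires a value that is neither 0 nor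
    infinite.\<close>
  also have "capital_Z V p / capital_Z V p = 1"
    using partition_const_pos by (simp add: capital_Z_eq divide_ennreal)
  finally show "emeasure (capital_measure V p) (space (capital_measure V p)) = 1" .
qed

text \<open>Unfolding the density and substituting \<open>s = V x\<close> reduces every mean to an
  integral over the line with the same normalization.\<close>

lemma capital_mean_eq:
  assumes h: "h \<in> borel_measurable (restrict_space borel {0<..<1})"
    and int: "integrable lborel (\<lambda>x. V' x * exp (p * x) * h (V x))"
  shows "integrable (capital_measure V p) h"
    and "capital_mean V p h = (\<integral>x. V' x * exp (p * x) * h (V x) \<partial>lborel) / partition_const p"
proof -
  let ?R = "restrict_space lborel {0<..<1::real}"
  let ?w = "\<lambda>s. exp (p * wave_quantile V s) / partition_const p"
  have w: "?w \<in> borel_measurable (restrict_space borel {0<..<1})"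
    using measurable_weight by simp
  have wh: "(\<lambda>s. ?w s * h s) \<in> borel_measurable (restrict_space borel {0<..<1})"
    by (rule borel_measurable_times[OF w h])
  have eq: "V' x * (?w (V x) * h (V x)) = V' x * exp (p * x) * h (V x) / partition_const p" for x
    by simp
  have "integrable lborel (\<lambda>x. V' x * (?w (V x) * h (V x)))"
    unfolding eq using int by simp
  note sub = substitution[OF wh this]
  have mR: "h \<in> borel_measurable ?R" "?w \<in> borel_measurable ?R" "AE s in ?R. 0 \<le> ?w s"
    using h w partition_const_pos by (simp_all add: measurable_restrict_lborel)
  show "integrable (capital_measure V p) h"
    unfolding capital_measure_eq integrable_density[OF mR]
    using sub(1) by (simp add: integrable_restrict_space set_integrable_def)
  have "capital_mean V p h = (LBINT s:{0<..<1}. ?w s * h s)"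
    unfolding capital_mean_def capital_measure_eq integral_density[OF mR]
    by (simp add: integral_restrict_space set_lebesgue_integral_def)
  also have "\<dots> = (\<integral>x. V' x * exp (p * x) * h (V x) / partition_const p \<partial>lborel)"
    unfolding sub(2) eq ..
  finally show "capital_mean V p h
      = (\<integral>x. V' x * exp (p * x) * h (V x) \<partial>lborel) / partition_const p"
    by simp
qed

end

end

section \<open>Tails of the traveling wave\<close>

text \<open>The wave equation is kept in divergence form, as a derivative of the whole flux. The
  constants \<open>k0\<close> and \<open>k1\<close> are the negated slopes of \<open>ft\<close> at
  the endpoints.\<close>

locale wave_profile = profile +
  fixes \<sigma>2 bt ft :: "real \<Rightarrow> real" and c k0 k1 :: real
  assumes continuous_\<sigma>2: "continuous_on {0..1} \<sigma>2"
    and continuous_bt: "continuous_on {0..1} bt"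
    and continuous_ft: "continuous_on {0..1} ft"
    and \<sigma>2_pos: "\<And>s. s \<in> {0..1} \<Longrightarrow> 0 < \<sigma>2 s"
    and ft_0: "ft 0 = 0" and ft_1: "ft 1 = 0"
    and DERIV_ft_0: "(ft has_real_derivative - k0) (at 0 within {0..1})"
    and DERIV_ft_1: "(ft has_real_derivative - k1) (at 1 within {0..1})"
    and k0_pos: "0 < k0" and k1_pos: "0 < k1"
    and DERIV_flux: "\<And>x. ((\<lambda>x. \<sigma>2 (V x) / 2 * V' x) has_real_derivative
      - (c - bt (V x)) * V' x - ft (V x)) (at x)"
begin

lemma continuous_comp_V: "continuous_on {0..1} h \<Longrightarrow> continuous_on UNIV (\<lambda>x. h (V x))"
  by (rule continuous_on_compose2[OF _ continuous_V]) (auto simp: less_imp_le V_bounds)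

text \<open>Since \<open>V\<close> stays in the interval and never attains the endpoint, one-sided
  limits and difference quotients there can be composed with \<open>V\<close>.\<close>

lemma filterlim_V_at_top: "filterlim V (at 1 within {0..1}) at_top"
  unfolding filterlim_at using V_at_top V_bounds by (simp add: less_imp_le less_imp_neq)

lemma filterlim_V_at_bot: "filterlim V (at 0 within {0..1}) at_bot"
  unfolding filterlim_at using V_at_bot V_bounds by (simp add: less_imp_le less_imp_neq[symmetric])

lemma tendsto_comp_V:
  assumes "continuous_on {0..1} h"
  shows "((\<lambda>x. h (V x)) \<longlongrightarrow> h 1) at_top" "((\<lambda>x. h (V x)) \<longlongrightarrow> h 0) at_bot"
proof -
  have "(h \<longlongrightarrow> h 1) (at 1 within {0..1})" "(h \<longlongrightarrow> h 0) (at 0 within {0..1})"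
    using assms by (auto simp: continuous_on_def)
  then show "((\<lambda>x. h (V x)) \<longlongrightarrow> h 1) at_top" "((\<lambda>x. h (V x)) \<longlongrightarrow> h 0) at_bot"
    by (auto intro: filterlim_compose filterlim_V_at_top filterlim_V_at_bot)
qed

lemma reaction_ratio_at_top: "((\<lambda>x. ft (V x) / (1 - V x)) \<longlongrightarrow> k1) at_top"
proof -
  have "((\<lambda>y. (ft y - ft 1) / (y - 1)) \<longlongrightarrow> - k1) (at 1 within {0..1})"
    using DERIV_ft_1 by (simp add: has_field_derivative_iff)
  from tendsto_minus[OF filterlim_compose[OF this filterlim_V_at_top]]
  show ?thesis by (simp add: ft_1 minus_divide_right)
qed

lemma reaction_ratio_at_bot: "((\<lambda>x. - ft (V x) / V x) \<longlongrightarrow> k0) at_bot"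
proof -
  have "((\<lambda>y. (ft y - ft 0) / (y - 0)) \<longlongrightarrow> - k0) (at 0 within {0..1})"
    using DERIV_ft_0 by (simp add: has_field_derivative_iff)
  from tendsto_minus[OF filterlim_compose[OF this filterlim_V_at_bot]]
  show ?thesis by (simp add: ft_0)
qed

text \<open>Instance of \<open>exponential_decay_at_top\<close> with \<open>U = 1 - V\<close>,
  \<open>S = \<sigma>2 (V) / 2\<close>, \<open>A = c - bt (V)\<close> and \<open>F = ft (V)\<close>.
  The reaction inherits the rate of \<open>1 - V\<close> because their ratio converges.\<close>

lemma decay_at_top:
  assumes "0 < r" "\<sigma>2 1 / 2 * r\<^sup>2 - (c - bt 1) * r < k1"
  shows "V' \<in> O(\<lambda>x. exp (- r * x))" "(\<lambda>x. ft (V x)) \<in> O(\<lambda>x. exp (- r * x))"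
proof -
  have dU: "((\<lambda>x. 1 - V x) has_real_derivative - V' x) (at x)" for x
    by (auto intro!: derivative_eq_intros DERIV_V)
  have U: "(\<lambda>x. 1 - V x) \<in> O(\<lambda>x. exp (- r * x)) \<and> V' \<in> O(\<lambda>x. exp (- r * x))"
    by (intro conjI exponential_decay_at_top[OF dU DERIV_flux, of "\<sigma>2 1 / 2" "c - bt 1" k1 r])
      (use assms V'_nonneg V_bounds reaction_ratio_at_top k1_pos \<sigma>2_pos[of 1]
        tendsto_comp_V(1)[OF continuous_\<sigma>2] tendsto_comp_V(1)[OF continuous_bt] in
        \<open>auto intro!: tendsto_intros\<close>)
  then show "V' \<in> O(\<lambda>x. exp (- r * x))" by blast
  have "(\<lambda>x. ft (V x)) \<in> O(\<lambda>x. 1 - V x)"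
    by (rule bigoI_tendsto[OF reaction_ratio_at_top])
      (auto intro!: always_eventually simp: less_imp_neq[OF V_bounds(2)])
  with U show "(\<lambda>x. ft (V x)) \<in> O(\<lambda>x. exp (- r * x))"
    by (blast intro: landau_o.big.trans)
qed

lemma decay_at_bot:
  obtains q where "0 < q" "V' \<in> O[at_bot](\<lambda>x. exp (q * x))"
    "(\<lambda>x. ft (V x)) \<in> O[at_bot](\<lambda>x. exp (q * x))"
proof -
  \<comment> \<open>The characteristic polynomial vanishes at \<open>q = 0\<close> and
    \<open>k0\<close> is positive, so by continuity every small positive rate is admissible.\<close>
  have "((\<lambda>q. \<sigma>2 0 / 2 * q\<^sup>2 - (- (c - bt 0)) * q) \<longlongrightarrow> \<sigma>2 0 / 2 * 0\<^sup>2 - (- (c - bt 0)) * 0)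
      (at_right 0)"
    by (intro tendsto_intros)
  from order_tendstoD(2)[OF this, of k0]
  have "\<forall>\<^sub>F q in at_right 0. \<sigma>2 0 / 2 * q\<^sup>2 - (- (c - bt 0)) * q < k0 \<and> 0 < q"
    using k0_pos by (auto simp: eventually_conj_iff eventually_at_right_less)
  then obtain q where q: "\<sigma>2 0 / 2 * q\<^sup>2 - (- (c - bt 0)) * q < k0" "0 < q"
    by (metis (no_types, lifting) eventually_happens trivial_limit_at_right_real)
  have neg: "(uminus has_real_derivative - 1) (at x)" for x :: real
    by (auto intro!: derivative_eq_intros)
  \<comment> \<open>After reflection \<open>V (- x)\<close> takes the role of the decreasing
    \<open>U\<close>; the flux keeps its sign, while the drift coefficient and the reaction change
    theirs.\<close>
  have dV: "((\<lambda>x. V (- x)) has_real_derivative - V' (- x)) (at x)" for x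
    using DERIV_chain2[OF DERIV_V neg] by simp
  have dW: "((\<lambda>x. \<sigma>2 (V (- x)) / 2 * V' (- x)) has_real_derivative
      - (- (c - bt (V (- x)))) * V' (- x) - (- ft (V (- x)))) (at x)" for x
    by (rule DERIV_cong[OF DERIV_chain2[OF DERIV_flux neg]]) (simp add: algebra_simps)
  have refl: "((\<lambda>x. f (- x)) \<longlongrightarrow> l) at_top" if "(f \<longlongrightarrow> l) at_bot" for f :: "real \<Rightarrow> real" and l
    using that by (simp add: filterlim_at_bot_mirror)
  have U: "(\<lambda>x. V (- x)) \<in> O(\<lambda>x. exp (- q * x)) \<and> (\<lambda>x. V' (- x)) \<in> O(\<lambda>x. exp (- q * x))"
    by (intro conjI exponential_decay_at_top[OF dV dW, of "\<sigma>2 0 / 2" "- (c - bt 0)" k0 q])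
      (use q V'_nonneg V_bounds refl[OF reaction_ratio_at_bot] k0_pos \<sigma>2_pos[of 0]
        refl[OF tendsto_comp_V(2)[OF continuous_\<sigma>2]] refl[OF tendsto_comp_V(2)[OF continuous_bt]] in
        \<open>auto intro!: tendsto_intros\<close>)
  have unrefl: "f \<in> O[at_bot](\<lambda>x. exp (q * x))"
    if "(\<lambda>x. f (- x)) \<in> O(\<lambda>x. exp (- q * x))" for f :: "real \<Rightarrow> real"
    using that by (simp add: at_bot_mirror landau_o.big.in_filtermap_iff)
  have V: "V \<in> O[at_bot](\<lambda>x. exp (q * x))" and V': "V' \<in> O[at_bot](\<lambda>x. exp (q * x))"
    using U unrefl by blast+
  have "(\<lambda>x. - ft (V x)) \<in> O[at_bot](V)"
    by (rule bigoI_tendsto[OF reaction_ratio_at_bot])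
      (auto intro!: always_eventually simp: less_imp_neq[OF V_bounds(1), symmetric])
  then have "(\<lambda>x. ft (V x)) \<in> O[at_bot](\<lambda>x. exp (q * x))"
    using V by (auto intro: landau_o.big.trans)
  with q(2) V' show thesis by (rule that)
qed

text \<open>
  A zero of \<open>V'\<close> minimizes the flux.  Hence the junk value \<open>ft / 0 = 0\<close> in the quotient of the
  reaction by the slope agrees with \<open>ft\<close>, and positivity of the slope is never needed.
\<close>

lemma reaction_eq_0_of_stationary:
  assumes "V' x = 0"
  shows "ft (V x) = 0"
proof -
  have "- (c - bt (V x)) * V' x - ft (V x) = 0"
  proof (rule DERIV_local_min[OF DERIV_flux zero_less_one], intro allI impI)
    fix y
    have "0 < \<sigma>2 (V y)" using V_bounds[of y] by (intro \<sigma>2_pos) auto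
    then show "\<sigma>2 (V x) / 2 * V' x \<le> \<sigma>2 (V y) / 2 * V' y"
      using V'_nonneg[of y] assms by simp
  qed
  then show ?thesis using assms by simp
qed

section \<open>Weighted integrals and the balance identity\<close>

context
  fixes p r :: real
  assumes p: "0 \<le> p" "p < r" and r: "\<sigma>2 1 / 2 * r\<^sup>2 - (c - bt 1) * r < k1"
begin

text \<open>At \<open>+\<infinity>\<close> the weight uses up \<open>p\<close> of the rate
  \<open>r\<close>. At \<open>-\<infinity>\<close> it is at most 1 on the negative half-line,
  because \<open>0 \<le> p\<close>, and the rate \<open>q\<close> survives.\<close>

lemma weighted_tails:
  fixes f :: "real \<Rightarrow> real"
  assumes "f \<in> O(\<lambda>x. exp (- r * x))" "f \<in> O[at_bot](\<lambda>x. exp (q * x))"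
  shows "(\<lambda>x. f x * exp (p * x)) \<in> O(\<lambda>x. exp (- (r - p) * x))"
    and "(\<lambda>x. f x * exp (p * x)) \<in> O[at_bot](\<lambda>x. exp (q * x))"
proof -
  have "(\<lambda>x. f x * exp (p * x)) \<in> O(\<lambda>x. exp (- r * x) * exp (p * x))"
    using assms(1) by (intro landau_o.big.mult) auto
  then show "(\<lambda>x. f x * exp (p * x)) \<in> O(\<lambda>x. exp (- (r - p) * x))"
    by (simp add: exp_add[symmetric] algebra_simps)
  have "(\<lambda>x. exp (p * x)) \<in> O[at_bot](\<lambda>x. 1)"
    by (rule bigoI[of _ 1], rule eventually_mono[OF eventually_le_at_bot[of 0]])
      (use p(1) in \<open>auto simp: mult_nonneg_nonpos\<close>)
  from landau_o.big.mult[OF assms(2) this]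
  show "(\<lambda>x. f x * exp (p * x)) \<in> O[at_bot](\<lambda>x. exp (q * x))" by simp
qed

lemma integrable_weighted:
  shows "integrable lborel (\<lambda>x. V' x * exp (p * x))"
    and "integrable lborel (\<lambda>x. ft (V x) * exp (p * x))"
    and "((\<lambda>x. V' x * exp (p * x)) \<longlongrightarrow> 0) at_top" "((\<lambda>x. V' x * exp (p * x)) \<longlongrightarrow> 0) at_bot"
proof -
  have "0 < r" "0 < r - p" using p by auto
  note top = decay_at_top[OF \<open>0 < r\<close> r]
  obtain q where q: "0 < q" "V' \<in> O[at_bot](\<lambda>x. exp (q * x))"
    "(\<lambda>x. ft (V x)) \<in> O[at_bot](\<lambda>x. exp (q * x))"
    by (rule decay_at_bot)
  note V' = weighted_tails[OF top(1) q(2)] and f = weighted_tails[OF top(2) q(3)]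
  show "integrable lborel (\<lambda>x. V' x * exp (p * x))"
    by (rule integrable_exponential_tails[OF _ \<open>0 < r - p\<close> q(1) V'])
      (intro continuous_intros continuous_V')
  show "integrable lborel (\<lambda>x. ft (V x) * exp (p * x))"
    by (rule integrable_exponential_tails[OF _ \<open>0 < r - p\<close> q(1) f])
      (intro continuous_intros continuous_comp_V continuous_ft)
  have "(\<lambda>x. exp (- (r - p) * x)) \<in> o(\<lambda>x. 1)"
    using \<open>0 < r - p\<close> by real_asymp
  from smalloD_tendsto[OF landau_o.big_small_trans[OF V'(1) this]]
  show "((\<lambda>x. V' x * exp (p * x)) \<longlongrightarrow> 0) at_top" by simp
  have "(\<lambda>x. exp (q * x)) \<in> o[at_bot](\<lambda>x. 1)"
    using q(1) by real_asymp
  from smalloD_tendsto[OF landau_o.big_small_trans[OF V'(2) this]]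
  show "((\<lambda>x. V' x * exp (p * x)) \<longlongrightarrow> 0) at_bot" by simp
qed

lemma integrable_weighted_mult:
  assumes h: "continuous_on {0..1} h"
  shows "integrable lborel (\<lambda>x. V' x * exp (p * x) * h (V x))"
proof -
  have "bounded (h ` {0..1})"
    using h by (intro compact_imp_bounded compact_continuous_image) auto
  then obtain B where B: "\<And>s. s \<in> {0..1} \<Longrightarrow> norm (h s) \<le> B"
    by (metis bounded_iff imageI)
  have "norm (V' x * exp (p * x) * h (V x)) \<le> norm (B * (V' x * exp (p * x)))" for x
  proof -
    have "norm (h (V x)) \<le> \<bar>B\<bar>"
      using B[of "V x"] V_bounds[of x] by fastforce
    then have "\<bar>V' x * exp (p * x)\<bar> * norm (h (V x)) \<le> \<bar>V' x * exp (p * x)\<bar> * \<bar>B\<bar>"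
      by (rule mult_left_mono) simp
    then show ?thesis by (simp add: abs_mult mult_ac)
  qed
  moreover have "continuous_on UNIV (\<lambda>x. V' x * exp (p * x) * h (V x))"
    by (intro continuous_intros continuous_V' continuous_comp_V h)
  ultimately show ?thesis
    by (intro Bochner_Integration.integrable_bound
        [OF integrable_mult_right[OF integrable_weighted(1), of B]])
      (auto intro!: borel_measurable_continuous_onI)
qed

lemma capital_mean_continuous:
  assumes "continuous_on {0..1} h"
  shows "integrable (capital_measure V p) h"
    and "capital_mean V p h = (\<integral>x. V' x * exp (p * x) * h (V x) \<partial>lborel) / partition_const p"
  using capital_mean_eq[OF integrable_weighted(1) measurable_of_continuous_unit[OF assms]
      integrable_weighted_mult[OF assms]] by blast+

text \<open>The Jacobian cancels the slope in the denominator, so integrability rests on the tails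
  of \<open>ft (V x)\<close> and not on a lower bound for the slope.\<close>

lemma capital_mean_reaction:
  shows "integrable (capital_measure V p) (\<lambda>s. ft s / quantile_slope V s)"
    and "capital_mean V p (\<lambda>s. ft s / quantile_slope V s)
      = (\<integral>x. ft (V x) * exp (p * x) \<partial>lborel) / partition_const p"
proof -
  \<comment> \<open>Where \<open>V' x = 0\<close>, both sides vanish, the right one by
    \<open>reaction_eq_0_of_stationary\<close>.\<close>
  have eq: "V' x * exp (p * x) * (ft (V x) / quantile_slope V (V x)) = ft (V x) * exp (p * x)" for x
    using reaction_eq_0_of_stationary[of x] by simp
  have "(\<lambda>s. ft s / quantile_slope V s) \<in> borel_measurable (restrict_space borel {0<..<1})"
    by (intro borel_measurable_divide measurable_of_continuous_unit continuous_ft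
        borel_measurable_continuous_on_restrict continuous_quantile_slope)
  note * = capital_mean_eq[OF integrable_weighted(1) this, unfolded eq, OF integrable_weighted(2)]
  show "integrable (capital_measure V p) (\<lambda>s. ft s / quantile_slope V s)"
    "capital_mean V p (\<lambda>s. ft s / quantile_slope V s)
      = (\<integral>x. ft (V x) * exp (p * x) \<partial>lborel) / partition_const p"
    by (fact *)+
qed

text \<open>The wave equation tested against \<open>exp (p * x)\<close>: the weighted flux vanishes
  at both ends, so its derivative integrates to 0, and division by \<open>partition_const p\<close>
  turns the integrals into means.\<close>

lemma capital_mean_reaction_balance:
  "capital_mean V p (\<lambda>s. ft s / quantile_slope V s)
    = p / 2 * capital_mean V p \<sigma>2 - c + capital_mean V p bt"
proof -
  let ?w = "\<lambda>x. V' x * exp (p * x)"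
  \<comment> \<open>The derivative of the weighted flux: the \<open>\<sigma>2\<close> term comes
    from differentiating the exponential, the others from the wave equation.\<close>
  let ?g = "\<lambda>x. p / 2 * (?w x * \<sigma>2 (V x)) - c * ?w x + ?w x * bt (V x) - ft (V x) * exp (p * x)"
  note int = integrable_weighted_mult[OF continuous_\<sigma>2] integrable_weighted_mult[OF continuous_bt]
    integrable_weighted(1,2)
  have "(\<integral>x. ?g x \<partial>lborel) = 0"
  proof (rule integral_derivative_vanishing_limits)
    fix x
    have "((\<lambda>x. exp (p * x)) has_real_derivative p * exp (p * x)) (at x)"
      by (auto intro!: derivative_eq_intros)
    from DERIV_mult[OF this DERIV_flux]
    show "((\<lambda>x. exp (p * x) * (\<sigma>2 (V x) / 2 * V' x)) has_real_derivative ?g x) (at x)"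
      by (rule DERIV_cong) (simp add: algebra_simps)
  next
    show "continuous_on UNIV ?g"
      by (intro continuous_intros continuous_V' continuous_comp_V continuous_\<sigma>2 continuous_bt
          continuous_ft)
    show "integrable lborel ?g"
      using int by (auto intro!: Bochner_Integration.integrable_add Bochner_Integration.integrable_diff)
    have eq: "exp (p * x) * (\<sigma>2 (V x) / 2 * V' x) = ?w x * (\<sigma>2 (V x) / 2)" for x
      by simp
    have "((\<lambda>x. ?w x * (\<sigma>2 (V x) / 2)) \<longlongrightarrow> 0 * (\<sigma>2 0 / 2)) at_bot"
      by (intro tendsto_intros integrable_weighted tendsto_comp_V continuous_\<sigma>2) simp
    then show "((\<lambda>x. exp (p * x) * (\<sigma>2 (V x) / 2 * V' x)) \<longlongrightarrow> 0) at_bot"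
      unfolding eq by simp
    have "((\<lambda>x. ?w x * (\<sigma>2 (V x) / 2)) \<longlongrightarrow> 0 * (\<sigma>2 1 / 2)) at_top"
      by (intro tendsto_intros integrable_weighted tendsto_comp_V continuous_\<sigma>2) simp
    then show "((\<lambda>x. exp (p * x) * (\<sigma>2 (V x) / 2 * V' x)) \<longlongrightarrow> 0) at_top"
      unfolding eq by simp
  qed
  then have "p / 2 * (\<integral>x. ?w x * \<sigma>2 (V x) \<partial>lborel) - c * (\<integral>x. ?w x \<partial>lborel)
      + (\<integral>x. ?w x * bt (V x) \<partial>lborel) - (\<integral>x. ft (V x) * exp (p * x) \<partial>lborel) = 0"
    using int by simp
  then show ?thesis
    using partition_const_pos[OF integrable_weighted(1)]
    unfolding capital_mean_reaction(2) capital_mean_continuous(2)[OF continuous_\<sigma>2]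
      capital_mean_continuous(2)[OF continuous_bt]
    by (simp add: partition_const_def field_simps)
qed

text \<open>The Ito correction contributes one copy of the excess growth rate; eliminating the mean
  of \<open>bt\<close> by the balance identity subtracts \<open>p\<close> copies.\<close>

lemma growth_rate_eq:
  "growth_rate \<sigma>2 bt ld V p
    = c + (1 - p) * excess_growth_rate \<sigma>2 V p
      + capital_mean V p (\<lambda>s. ft s / quantile_slope V s) - capital_mean V p ld"
proof -
  have "capital_mean V p (\<lambda>s. bt s + \<sigma>2 s / 2)
      = capital_mean V p bt + capital_mean V p \<sigma>2 / 2"
    unfolding capital_mean_def
    using capital_mean_continuous(1)[OF continuous_\<sigma>2]
      capital_mean_continuous(1)[OF continuous_bt] by simp
  then show ?thesis
    unfolding growth_rate_def excess_growth_rate_def capital_mean_reaction_balance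
    by (simp add: field_simps)
qed

end

end

section \<open>Verification of the assumptions for the given wave\<close>

lemma C1_unit_imp_continuous: "C1_unit h \<Longrightarrow> continuous_on {0..1} h"
  by (simp add: C1_unit_def differentiable_imp_continuous_on)

lemma C1_unit_imp_DERIV:
  assumes "C1_unit h" "x \<in> {0..1}"
  shows "(h has_real_derivative deriv_unit h x) (at x within {0..1})"
  using assms unfolding C1_unit_def deriv_unit_def differentiable_on_def
  by (simp add: has_real_derivative_iff_has_vector_derivative vector_derivative_works)

lemma C1_differentiable_on_UNIV_real:
  fixes f :: "real \<Rightarrow> real"
  assumes "f C1_differentiable_on UNIV"
  shows "(f has_real_derivative deriv f x) (at x)" "continuous_on UNIV (deriv f)"
proof -
  obtain D where D: "\<And>x. (f has_real_derivative D x) (at x)" "continuous_on UNIV D"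
    using assms
    by (auto simp: C1_differentiable_on_def has_real_derivative_iff_has_vector_derivative)
  have "deriv f = D" using D(1) by (auto intro: DERIV_imp_deriv)
  with D show "(f has_real_derivative deriv f x) (at x)" "continuous_on UNIV (deriv f)" by auto
qed

text \<open>The first two conjuncts guard the identity against default values: a degenerate
  normalization, or the value 0 of the integral of a non-integrable function.\<close>

theorem proposition6p1:
  fixes \<sigma>2 bt lb ld V :: "real \<Rightarrow> real" and c p qs :: real
  defines "ft \<equiv> reaction lb ld"
  assumes "continuous_on {0..1} lb" and "\<forall>q\<in>{0..1}. 0 \<le> lb q"
    and "continuous_on {0..1} ld" and "\<forall>q\<in>{0..1}. 0 \<le> ld q"
    and "C1_unit \<sigma>2" and "C1_unit bt" and "0 < (INF q\<in>{0..1}. \<sigma>2 q)"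
    and "C1_unit ft" and "ft 0 = 0" and "ft 1 = 0"
    and "{q \<in> {0<..<1}. ft q = 0} = {qs}"
    and "\<forall>q\<in>{0<..<qs}. ft q < 0" and "\<forall>q\<in>{qs<..<1}. 0 < ft q"
    and "deriv_unit ft 0 < 0" and "0 < deriv_unit ft qs" and "deriv_unit ft 1 < 0"
    and "traveling_wave \<sigma>2 bt ft c V"
    and "0 \<le> p" and "p < tail_exponent \<sigma>2 bt ft c"
  shows "prob_space (capital_measure V p)
    \<and> integrable (capital_measure V p) (\<lambda>s. ft s / quantile_slope V s)
    \<and> growth_rate \<sigma>2 bt ld V p
        = c + (1 - p) * excess_growth_rate \<sigma>2 V p
            + capital_mean V p (\<lambda>s. ft s / quantile_slope V s)
            - capital_mean V p ld"
proof -
  note wave = \<open>traveling_wave \<sigma>2 bt ft c V\<close>[unfolded traveling_wave_def]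
  interpret profile V "deriv V"
    by unfold_locales (use wave C1_differentiable_on_UNIV_real in auto)
  have \<sigma>2_pos: "0 < \<sigma>2 s" if "s \<in> {0..1}" for s
  \<comment> \<open>The infimum bounds the values from below only if these are bounded below, which
    compactness of the image supplies.\<close>
  proof -
    have "compact (\<sigma>2 ` {0..1})"
      by (intro compact_continuous_image C1_unit_imp_continuous \<open>C1_unit \<sigma>2\<close>) simp
    then have "(INF q\<in>{0..1}. \<sigma>2 q) \<le> \<sigma>2 s"
      using that by (intro cINF_lower bounded_imp_bdd_below compact_imp_bounded) auto
    with \<open>0 < (INF q\<in>{0..1}. \<sigma>2 q)\<close> show ?thesis by simp
  qed
  \<comment> \<open>In the wave equation \<open>deriv\<close> is a total operator, so the flux must
    first be shown differentiable; the equation then identifies its derivative.\<close>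
  have flux: "((\<lambda>x. \<sigma>2 (V x) / 2 * deriv V x) has_real_derivative
      - (c - bt (V x)) * deriv V x - ft (V x)) (at x)" for x
  proof -
    have "(\<sigma>2 has_real_derivative deriv_unit \<sigma>2 (V x)) (at (V x) within {0..1})"
      using C1_unit_imp_DERIV[OF \<open>C1_unit \<sigma>2\<close>, of "V x"] V_bounds[of x] by simp
    \<comment> \<open>As \<open>V x\<close> is an interior point, the derivative within the interval
      is a full one.\<close>
    then have "(\<sigma>2 has_real_derivative deriv_unit \<sigma>2 (V x)) (at (V x))"
      using V_bounds[of x] by (simp add: at_within_Icc_at)
    from DERIV_mult[OF DERIV_cdivide[OF DERIV_chain2[OF this DERIV_V], of 2]
        C1_differentiable_on_UNIV_real(1)]
    have "(\<lambda>x. \<sigma>2 (V x) / 2 * deriv V x) field_differentiable (at x)"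
      using wave by (auto simp: field_differentiable_def)
    then have "((\<lambda>x. \<sigma>2 (V x) / 2 * deriv V x) has_real_derivative
        deriv (\<lambda>x. \<sigma>2 (V x) / 2 * deriv V x) x) (at x)"
      by (rule field_differentiable_derivI)
    then show ?thesis
      by (rule DERIV_cong) (use wave in \<open>simp add: algebra_simps eq_neg_iff_add_eq_0\<close>)
  qed
  interpret wave_profile V "deriv V" \<sigma>2 bt ft c "- deriv_unit ft 0" "- deriv_unit ft 1"
    by unfold_locales
      (use \<sigma>2_pos flux assms C1_unit_imp_DERIV[OF \<open>C1_unit ft\<close>] in
        \<open>auto intro: C1_unit_imp_continuous\<close>)
  \<comment> \<open>The gap between \<open>p\<close> and the tail exponent leaves the positive decay
    rate \<open>r - p\<close> after weighting.\<close>
  obtain r where r: "p < r" "r < tail_exponent \<sigma>2 bt ft c"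
    using dense \<open>p < tail_exponent \<sigma>2 bt ft c\<close> by blast
  \<comment> \<open>With \<open>s = \<sigma>2 1 / 2\<close> and
    \<open>k = - deriv_unit ft 1\<close>, the positive root in the quadratic lemma is exactly
    \<open>tail_exponent\<close>.\<close>
  have "\<sigma>2 1 / 2 * r\<^sup>2 - (c - bt 1) * r < - deriv_unit ft 1"
    by (rule between_roots_imp_quadratic_neg)
      (use r \<sigma>2_pos[of 1] \<open>0 \<le> p\<close> \<open>deriv_unit ft 1 < 0\<close> in
        \<open>auto simp: tail_exponent_def Let_def\<close>)
  note * = \<open>0 \<le> p\<close> \<open>p < r\<close> this
  show ?thesis
    using prob_space_capital_measure[OF integrable_weighted(1)[OF *]]
      capital_mean_reaction(1)[OF *] growth_rate_eq[OF *] by blast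
qed

end
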